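(* For every integer $n\ge 2$, the number $t(n)$ of toppleable permutations in $S_n$ satisfies \[ t(n)=t_{\lfloor n/2\rfloor+1}(n)=t_{\lfloor n/2\rfloor+2}(n), \] and moreover $t(n)=a_{n,\lfloor (n-1)/2\rfloor}$, where $a_{n,k}$ denotes the number of permutations $\sigma\in S_n$ whose excedance set is exactly $\{1,\dots,k\}$.
   Context: Toppling model. For an integer $n\ge 2$ let $L_n=\{-\lfloor (n+1)/2\rfloor,\dots,-1,0,1,\dots,\lfloor n/2\rfloor+1\}\subset\mathbb{Z}$; position $0$ is the origin. A configuration places chips carrying distinct integer labels at positions of $L_n$ (a position may hold several chips). A toppling move chooses a position $i$ holding at least two chips, chooses two chips $\alpha<\beta$ at $i$, and moves $\alpha$ to $i-1$ and $\beta$ to $i+1$. The toppling process applies toppling moves (with arbitrary choices) until no position holds two or more chips. For $\pi=(\pi_1,\dots,\pi_n)\in S_n$ and $r\in[n+1]=\{1,\dots,n+1\}$, the initial configuration $\pi^{(r)}$ has, for each $j=1,\dots,n$, one chip at position $-\lfloor (n-1)/2\rfloor+j-1$ labeled $\pi_j$ if $\pi_j<r$ and $\pi_j+1$ if $\pi_j\ge r$, and in addition a chip labeled $r$ at the origin; thus there are $n+1$ chips labeled $1,\dots,n+1$. Starting from $\pi^{(r)}$ the process stops with a final configuration that does not depend on the choices and has at most one chip per position; reading its chips from left to right gives a permutation $\mathcal{T}(\pi,r)\in S_{n+1}$. A permutation $\pi\in S_n$ is $r$-toppleable if $\mathcal{T}(\pi,r)$ is the identity, and toppleable if it is $r$-toppleable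 for every $r\in[n+1]$. Let $t_r(n)$ be the number of $r$-toppleable permutations in $S_n$ and $t(n)$ the number of toppleable ones. An excedance of $\sigma\in S_n$ is an index $i$ with $\sigma_i>i$; the excedance set is the set of all excedances. *)

theory Defs
  imports Main "HOL-Combinatorics.Permutations"
begin

text \<open>
  A permutation in $S_n$ is a function \<open>\<pi> :: nat \<Rightarrow> nat\<close> with \<open>\<pi> permutes {1..n}\<close>;
  it is the identity outside \<open>{1..n}\<close>.
\<close>

definition positions :: "nat \<Rightarrow> int set" where
  "positions n = {- int ((n + 1) div 2) .. int (n div 2) + 1}"

text \<open>A configuration maps each position to the set of labels of the chips lying there.\<close>

type_synonym config = "int \<Rightarrow> nat set"

text \<open>
  Chips never leave \<open>positions n\<close> when starting from the initial configurations below, so the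
  targets \<open>i - 1\<close> and \<open>i + 1\<close> carry no side condition.
\<close>

inductive topple :: "nat \<Rightarrow> config \<Rightarrow> config \<Rightarrow> bool" for n :: nat where
  move: "i \<in> positions n \<Longrightarrow> \<alpha> \<in> c i \<Longrightarrow> \<beta> \<in> c i \<Longrightarrow> \<alpha> < \<beta> \<Longrightarrow>
    topple n c (c(i := c i - {\<alpha>, \<beta>},
                  i - 1 := insert \<alpha> (c (i - 1)),
                  i + 1 := insert \<beta> (c (i + 1))))"

definition stable :: "nat \<Rightarrow> config \<Rightarrow> bool" where
  "stable n c \<longleftrightarrow> (\<forall>i \<in> positions n. finite (c i) \<and> card (c i) \<le> 1)"

definition init_config :: "nat \<Rightarrow> (nat \<Rightarrow> nat) \<Rightarrow> nat \<Rightarrow> config" where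
  "init_config n \<pi> r = (\<lambda>i.
     {if \<pi> j < r then \<pi> j else \<pi> j + 1 | j.
        j \<in> {1..n} \<and> i = - int ((n - 1) div 2) + int j - 1}
     \<union> (if i = 0 then {r} else {}))"

text \<open>
  The stable configuration reached from \<open>init_config n \<pi> r\<close> exists and does not depend on the
  choices of moves, which justifies the definite description.
\<close>

definition final_config :: "nat \<Rightarrow> (nat \<Rightarrow> nat) \<Rightarrow> nat \<Rightarrow> config" where
  "final_config n \<pi> r = (THE c. (topple n)\<^sup>*\<^sup>* (init_config n \<pi> r) c \<and> stable n c)"

text \<open>
  The left-to-right reading word. It is applied to stable configurations only, where each
  \<open>sorted_list_of_set (c i)\<close> has length at most one.
\<close>

definition chip_word :: "nat \<Rightarrow> config \<Rightarrow> nat list" where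
  "chip_word n c =
     concat (map (\<lambda>i. sorted_list_of_set (c i)) [- int ((n + 1) div 2) .. int (n div 2) + 1])"

text \<open>\<open>T n \<pi> r\<close> is the permutation of \<open>{1..n+1}\<close> whose one-line notation is the reading word.\<close>

definition T :: "nat \<Rightarrow> (nat \<Rightarrow> nat) \<Rightarrow> nat \<Rightarrow> nat \<Rightarrow> nat" where
  "T n \<pi> r = (\<lambda>k. if k \<in> {1..n + 1} then chip_word n (final_config n \<pi> r) ! (k - 1) else k)"

definition r_toppleable :: "nat \<Rightarrow> nat \<Rightarrow> (nat \<Rightarrow> nat) \<Rightarrow> bool" where
  "r_toppleable n r \<pi> \<longleftrightarrow> T n \<pi> r = id"

definition toppleable :: "nat \<Rightarrow> (nat \<Rightarrow> nat) \<Rightarrow> bool" where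
  "toppleable n \<pi> \<longleftrightarrow> (\<forall>r \<in> {1..n + 1}. r_toppleable n r \<pi>)"

definition num_r_toppleable :: "nat \<Rightarrow> nat \<Rightarrow> nat" where
  "num_r_toppleable r n = card {\<pi>. \<pi> permutes {1..n} \<and> r_toppleable n r \<pi>}"

definition num_toppleable :: "nat \<Rightarrow> nat" where
  "num_toppleable n = card {\<pi>. \<pi> permutes {1..n} \<and> toppleable n \<pi>}"

definition excedance_set :: "nat \<Rightarrow> (nat \<Rightarrow> nat) \<Rightarrow> nat set" where
  "excedance_set n \<sigma> = {i \<in> {1..n}. \<sigma> i > i}"

definition num_excedance :: "nat \<Rightarrow> nat \<Rightarrow> nat" where
  "num_excedance n k = card {\<sigma>. \<sigma> permutes {1..n} \<and> excedance_set n \<sigma> = {1..k}}"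

end

theory Submission imports Defs begin

text \<open>
  Write $a = \lfloor (n-1)/2 \rfloor$ and $b = \lfloor n/2 \rfloor$, so $n = a + b + 1$. During the
  process no position ever holds three chips, so moves at different positions commute and the
  process is confluent. One legal schedule is a comparator network on an $(a+1) \times (b+1)$ grid:
  comparator $(x,y)$ acts at position $y - x$ on row wire $x$ (initially the chip at $-x$), which
  keeps the maximum, and on column wire $y$ (initially the chip at $y$), which keeps the minimum.
  Column values only decrease and row values only increase, and at the end every column value is
  below every row value. It follows that the output is sorted iff the chip on column $y$ starts with
  label at least $y+1$ and the chip on row $x$ starts with label at most $n+1-x$. In terms of $\pi$
  this is implied by $i - a \le \pi_i \le i + b$ for all $i$, and equivalent to it if
  $r \in \{b+1, b+2\}$. Multiplying such a $\pi$ on both sides by suitable involutions gives exactly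
  the permutations with excedance set $\{1,\dots,a\}$.
\<close>

section \<open>Confluence of the toppling process\<close>

text \<open>
  On the line with one extra chip, doubly occupied positions stay separated by empty ones; this is
  what prevents three chips from meeting.
\<close>

definition sparse :: "config \<Rightarrow> bool" where
  "sparse c \<longleftrightarrow> (\<forall>i. finite (c i) \<and> card (c i) \<le> 2) \<and>
     (\<forall>i j. i < j \<and> card (c i) = 2 \<and> card (c j) = 2 \<longrightarrow> (\<exists>k. i < k \<and> k < j \<and> c k = {}))"

text \<open>Neighbouring integers leave no room for the empty position that must separate two
  pairs.\<close>

lemma sparse_adjacent:
  assumes "sparse c" and "card (c i) = 2"
  shows "card (c (i - 1)) \<le> 1" "card (c (i + 1)) \<le> 1"
proof -
  have "\<not> card (c (i - 1)) = 2"
    using assms unfolding sparse_def by (smt (verit))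
  moreover have "\<not> card (c (i + 1)) = 2"
    using assms unfolding sparse_def by (smt (verit))
  ultimately show "card (c (i - 1)) \<le> 1" "card (c (i + 1)) \<le> 1"
    using assms(1) unfolding sparse_def by (metis One_nat_def Suc_1 le_Suc_eq)+
qed

lemma sparse_pair:
  assumes "sparse c" and "\<alpha> \<in> c i" and "\<beta> \<in> c i" and "\<alpha> < \<beta>"
  shows "c i = {\<alpha>, \<beta>}"
proof -
  have "card {\<alpha>, \<beta>} = 2"
    using assms(4) by simp
  moreover have "finite (c i)" "card (c i) \<le> 2"
    using assms(1) by (auto simp: sparse_def)
  ultimately have "{\<alpha>, \<beta>} = c i"
    using assms(2,3) by (intro card_seteq) simp_all
  then show ?thesis ..
qed

text \<open>The fired position becomes empty and separates the two sides. A new pair next to it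
  requires that the neighbour was occupied before, so the old gap towards the next pair on that side
  lies elsewhere and survives.\<close>

lemma sparse_topple:
  assumes "sparse c" and "topple n c c'"
  shows "sparse c'"
  using assms(2)
proof cases
  case (move i \<alpha> \<beta>)
  have ci: "c i = {\<alpha>, \<beta>}"
    using sparse_pair[OF assms(1)] move by blast
  then have card_i: "card (c i) = 2"
    using move by simp
  note adj = sparse_adjacent[OF assms(1) card_i]
  have fin: "finite (c j)" and le2: "card (c j) \<le> 2" for j
    using assms(1) unfolding sparse_def by auto
  have c'_i: "c' i = {}" and c'_l: "c' (i - 1) = insert \<alpha> (c (i - 1))"
    and c'_r: "c' (i + 1) = insert \<beta> (c (i + 1))"
    and c'_else: "\<And>j. j \<noteq> i \<Longrightarrow> j \<noteq> i - 1 \<Longrightarrow> j \<noteq> i + 1 \<Longrightarrow> c' j = c j"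
    using move(1) ci by auto
  have card_l: "card (c' (i - 1)) \<le> Suc (card (c (i - 1)))"
    and card_r: "card (c' (i + 1)) \<le> Suc (card (c (i + 1)))"
    using fin c'_l c'_r by (simp_all add: card_insert_le_m1 card_insert_if)
  have "finite (c' j) \<and> card (c' j) \<le> 2" for j
    using fin[of j] le2[of j] c'_i c'_l c'_r c'_else[of j] card_l card_r adj
    by (cases "j = i"; cases "j = i - 1"; cases "j = i + 1") auto
  moreover have "\<exists>k. p < k \<and> k < q \<and> c' k = {}"
    if "p < q" and p: "card (c' p) = 2" and q: "card (c' q) = 2" for p q
  proof -
    have ne: "p \<noteq> i" "q \<noteq> i"
      using p q c'_i by auto
    have gap: "\<exists>k. u < k \<and> k < v \<and> c k = {}"
      if "u < v" "card (c u) = 2" "card (c v) = 2" for u v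
      using assms(1) that unfolding sparse_def by blast
    have nonempty_l: "c (i - 1) \<noteq> {}" if "card (c' (i - 1)) = 2"
      using that c'_l by auto
    have nonempty_r: "c (i + 1) \<noteq> {}" if "card (c' (i + 1)) = 2"
      using that c'_r by auto
    consider "p < i" "i < q" | "q < i" | "i < p"
      using ne \<open>p < q\<close> by linarith
    then show ?thesis
    proof cases
      case 1
      then show ?thesis using c'_i by blast
    next
      case 2
      have "card (c p) = 2"
        using c'_else[of p] 2 \<open>p < q\<close> p by auto
      show ?thesis
      proof (cases "q = i - 1")
        case True
        obtain k where k: "p < k" "k < i" "c k = {}"
          using gap[of p i] \<open>card (c p) = 2\<close> card_i 2 \<open>p < q\<close> by auto
        then have "k \<noteq> i - 1"
          using nonempty_l True q by auto
        then show ?thesis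
          using k c'_else[of k] True by (intro exI[of _ k]) auto
      next
        case False
        then have "card (c q) = 2"
          using c'_else[of q] 2 q by auto
        then obtain k where "p < k" "k < q" "c k = {}"
          using gap[of p q] \<open>card (c p) = 2\<close> \<open>p < q\<close> by auto
        then show ?thesis
          using c'_else[of k] 2 False by (intro exI[of _ k]) auto
      qed
    next
      case 3
      have "card (c q) = 2"
        using c'_else[of q] 3 \<open>p < q\<close> q by auto
      show ?thesis
      proof (cases "p = i + 1")
        case True
        obtain k where k: "i < k" "k < q" "c k = {}"
          using gap[of i q] \<open>card (c q) = 2\<close> card_i 3 \<open>p < q\<close> by auto
        then have "k \<noteq> i + 1"
          using nonempty_r True p by auto
        then show ?thesis
          using k c'_else[of k] True by (intro exI[of _ k]) auto
      next
        case False
        then have "card (c p) = 2"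
          using c'_else[of p] 3 p by auto
        then obtain k where "p < k" "k < q" "c k = {}"
          using gap[of p q] \<open>card (c q) = 2\<close> \<open>p < q\<close> by auto
        then show ?thesis
          using c'_else[of k] 3 False by (intro exI[of _ k]) auto
      qed
    qed
  qed
  ultimately show ?thesis
    unfolding sparse_def by blast
qed

text \<open>Written as one reset plus unions rather than nested updates, so that two firings can be
  compared pointwise.\<close>

definition fire :: "int \<Rightarrow> nat \<Rightarrow> nat \<Rightarrow> config \<Rightarrow> config" where
  "fire i \<alpha> \<beta> c = (\<lambda>k. if k = i then {}
     else c k \<union> {x. k = i - 1 \<and> x = \<alpha> \<or> k = i + 1 \<and> x = \<beta>})"

lemma topple_fire:
  assumes "c i = {\<alpha>, \<beta>}"
  shows "c(i := c i - {\<alpha>, \<beta>}, i - 1 := insert \<alpha> (c (i - 1)), i + 1 := insert \<beta> (c (i + 1)))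
      = fire i \<alpha> \<beta> c"
    and "i \<in> positions n \<Longrightarrow> \<alpha> < \<beta> \<Longrightarrow> topple n c (fire i \<alpha> \<beta> c)"
proof -
  show eq: "c(i := c i - {\<alpha>, \<beta>}, i - 1 := insert \<alpha> (c (i - 1)), i + 1 := insert \<beta> (c (i + 1)))
      = fire i \<alpha> \<beta> c"
    using assms by (auto simp: fire_def fun_eq_iff)
  show "topple n c (fire i \<alpha> \<beta> c)" if "i \<in> positions n" "\<alpha> < \<beta>"
    unfolding eq[symmetric] using that assms by (intro topple.move) auto
qed

text \<open>Two distinct firing positions are never adjacent, so neither firing disturbs the other
  pair; a shared neighbour only receives chips. At a single position the pair to be moved is
  unique.\<close>

lemma topple_diamond:
  assumes "sparse c" and "topple n c c1" and "topple n c c2"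
  shows "c1 = c2 \<or> (\<exists>d. topple n c1 d \<and> topple n c2 d)"
  using assms(2)
proof cases
  case m1: (move i \<alpha> \<beta>)
  show ?thesis
    using assms(3)
  proof cases
    case m2: (move j \<gamma> \<delta>)
    have ci: "c i = {\<alpha>, \<beta>}" and cj: "c j = {\<gamma>, \<delta>}"
      using sparse_pair[OF assms(1)] m1 m2 by blast+
    then have "card (c i) = 2" "card (c j) = 2"
      using m1 m2 by simp_all
    then have "j \<noteq> i - 1" "j \<noteq> i + 1"
      using sparse_adjacent[OF assms(1), of i] by auto
    show ?thesis
    proof (cases "i = j")
      case True
      then have "\<alpha> = \<gamma> \<and> \<beta> = \<delta>"
        using ci cj m1 m2 by (auto simp: doubleton_eq_iff)
      then show ?thesis
        using True m1 m2 by simp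
    next
      case False
      have c1: "c1 = fire i \<alpha> \<beta> c" and c2: "c2 = fire j \<gamma> \<delta> c"
        using m1 m2 ci cj topple_fire by metis+
      have "c1 j = {\<gamma>, \<delta>}" "c2 i = {\<alpha>, \<beta>}"
        using ci cj False \<open>j \<noteq> i - 1\<close> \<open>j \<noteq> i + 1\<close> unfolding c1 c2 by (auto simp: fire_def)
      then have "topple n c1 (fire j \<gamma> \<delta> c1)" "topple n c2 (fire i \<alpha> \<beta> c2)"
        using m1 m2 topple_fire by auto
      moreover have "fire j \<gamma> \<delta> c1 = fire i \<alpha> \<beta> c2"
        using False \<open>j \<noteq> i - 1\<close> \<open>j \<noteq> i + 1\<close> unfolding c1 c2 by (auto simp: fire_def fun_eq_iff)
      ultimately show ?thesis by auto
    qed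
  qed
qed

section \<open>Uniqueness of the stable configuration\<close>

lemma stable_not_topple:
  assumes "stable n c"
  shows "\<not> topple n c c'"
proof
  assume "topple n c c'"
  then show False
  proof cases
    case (move i \<alpha> \<beta>)
    then have "card {\<alpha>, \<beta>} \<le> card (c i)"
      using assms by (intro card_mono) (auto simp: stable_def)
    then show False
      using move assms by (auto simp: stable_def)
  qed
qed

text \<open>The diamond is pushed along the given run, so any first step can still be completed to
  \<open>s\<close>. One known run to \<open>s\<close> takes the place of a termination
  argument.\<close>

lemma topple_step_to_stable:
  assumes "(topple n)\<^sup>*\<^sup>* c s" and "stable n s" and "sparse c" and "topple n c c'"
  shows "(topple n)\<^sup>*\<^sup>* c' s"
  using assms(1,3,4)
proof (induction arbitrary: c' rule: converse_rtranclp_induct)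
  case base
  then show ?case
    using stable_not_topple[OF assms(2)] by blast
next
  case (step c d)
  show ?case
  proof (cases "d = c'")
    case True
    then show ?thesis using step by simp
  next
    case False
    then obtain e where "topple n d e" "topple n c' e"
      using topple_diamond[of c n d c'] step by blast
    then show ?thesis
      using step.IH[of e] sparse_topple step by (meson converse_rtranclp_into_rtranclp)
  qed
qed

lemma stable_unique:
  assumes "(topple n)\<^sup>*\<^sup>* c s" and "(topple n)\<^sup>*\<^sup>* c s'" and "stable n s" and "stable n s'"
    and "sparse c"
  shows "s' = s"
proof -
  have "(topple n)\<^sup>*\<^sup>* s' s"
    using assms(2,1,5)
  proof (induction rule: converse_rtranclp_induct)
    case (step c d)
    then show ?case
      using topple_step_to_stable[of n c s d] sparse_topple assms(3) by blast
  qed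
  then show ?thesis
    using stable_not_topple[OF assms(4)] by (auto elim: converse_rtranclpE)
qed

lemma final_config_eq:
  assumes "sparse (init_config n \<pi> r)" and "(topple n)\<^sup>*\<^sup>* (init_config n \<pi> r) c" and "stable n c"
  shows "final_config n \<pi> r = c"
  unfolding final_config_def using assms by (blast intro: the_equality stable_unique)

section \<open>Toppling as a comparator network\<close>

text \<open>Separates trajectories \<open>pos\<close> from labels \<open>s\<close>: the wires move
  in a way that ignores the labels, and a toppling move only decides which label continues on which
  wire.\<close>

definition place :: "nat set \<Rightarrow> (nat \<Rightarrow> int) \<Rightarrow> (nat \<Rightarrow> nat) \<Rightarrow> config" where
  "place W pos s = (\<lambda>i. s ` {w \<in> W. pos w = i})"

lemma place_topple:
  assumes "i \<in> positions n" and uv: "{w \<in> W. pos w = i} = {u, v}" and "s u \<noteq> s v"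
  shows "topple n (place W pos s)
    (place W (pos(u := i + 1, v := i - 1)) (s(u := max (s u) (s v), v := min (s u) (s v))))"
proof -
  define \<alpha> where "\<alpha> = min (s u) (s v)"
  define \<beta> where "\<beta> = max (s u) (s v)"
  have "u \<noteq> v" and uvW: "u \<in> W" "v \<in> W" "pos u = i" "pos v = i"
    using assms(2,3) by auto
  have only: "w = u \<or> w = v" if "w \<in> W" "pos w = i" for w
    using that uv by blast
  have ci: "place W pos s i = {\<alpha>, \<beta>}"
    unfolding place_def uv \<alpha>_def \<beta>_def by (auto simp: min_def max_def)
  have "place W (pos(u := i + 1, v := i - 1)) (s(u := \<beta>, v := \<alpha>)) =
    (place W pos s)(i := place W pos s i - {\<alpha>, \<beta>},
       i - 1 := insert \<alpha> (place W pos s (i - 1)), i + 1 := insert \<beta> (place W pos s (i + 1)))"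
    (is "?l = ?r")
  proof
    fix j
    have rest: "{w \<in> W. (pos(u := i + 1, v := i - 1)) w = j} =
      {w \<in> W. pos w = j \<and> w \<noteq> u \<and> w \<noteq> v} \<union> (if j = i + 1 then {u} else {})
        \<union> (if j = i - 1 then {v} else {})"
      using \<open>u \<noteq> v\<close> uvW by auto
    have same: "{w \<in> W. pos w = j \<and> w \<noteq> u \<and> w \<noteq> v} =
        (if j = i then {} else {w \<in> W. pos w = j})"
      using only uvW by auto
    have im: "(s(u := \<beta>, v := \<alpha>)) ` {w \<in> W. pos w = j \<and> w \<noteq> u \<and> w \<noteq> v}
        = s ` {w \<in> W. pos w = j \<and> w \<noteq> u \<and> w \<noteq> v}"
      by (intro image_cong) auto
    have "?l j = s ` (if j = i then {} else {w \<in> W. pos w = j}) \<union>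
        (if j = i + 1 then {\<beta>} else {}) \<union> (if j = i - 1 then {\<alpha>} else {})"
      unfolding place_def rest image_Un im unfolding same using \<open>u \<noteq> v\<close> by simp
    also have "\<dots> = ?r j"
      using ci by (auto simp: place_def)
    finally show "?l j = ?r j" .
  qed
  moreover have "topple n (place W pos s) \<dots>"
    using ci assms by (intro topple.move) (auto simp: \<alpha>_def \<beta>_def min_def max_def)
  ultimately show ?thesis
    unfolding \<alpha>_def \<beta>_def by simp
qed

text \<open>
  Wires are indexed by their final place in the reading word: wire \<open>k \<le> b\<close> is column \<open>k\<close>, and wire
  \<open>k > b\<close> is row \<open>a + b + 1 - k\<close>. The network is run row by row, and the pair \<open>x y\<close> is the next
  comparator. A chip on row \<open>x'\<close> sits at (comparators passed) \<open>- x'\<close>, a chip on column \<open>y'\<close> at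
  \<open>y' -\<close> (comparators passed).
\<close>

definition wire_pos :: "nat \<Rightarrow> nat \<Rightarrow> nat \<Rightarrow> nat \<Rightarrow> nat \<Rightarrow> int" where
  "wire_pos a b x y k =
     (if k \<le> b then int k - int (if k < y then x + 1 else x)
      else int (if k = a + b + 1 - x then y else if a + b + 1 - x < k then b + 1 else 0)
        - int (a + b + 1 - k))"

text \<open>Sorted output means label \<open>k + 1\<close> on wire \<open>k\<close>. Column values
  only fall and row values only rise, so these inequalities on the start are necessary.\<close>

definition banded :: "nat \<Rightarrow> nat \<Rightarrow> (nat \<Rightarrow> nat) \<Rightarrow> bool" where
  "banded n b s \<longleftrightarrow> (\<forall>k\<le>b. k + 1 \<le> s k) \<and> (\<forall>k. b < k \<and> k \<le> n \<longrightarrow> s k \<le> k + 1)"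

text \<open>The ordering clause records the comparators already passed; it persists since column
  values fall and row values rise. The band is an implication because \<open>s0\<close> stays
  arbitrary until \<open>net_inv_final\<close>.\<close>

definition net_inv :: "nat \<Rightarrow> nat \<Rightarrow> (nat \<Rightarrow> nat) \<Rightarrow> nat \<Rightarrow> nat \<Rightarrow> (nat \<Rightarrow> nat) \<Rightarrow> bool" where
  "net_inv a b s0 x y s \<longleftrightarrow>
     bij_betw s {0..a + b + 1} {1..a + b + 2} \<and>
     (\<forall>x' y'. x' \<le> a \<and> y' \<le> b \<and> (x' < x \<or> x' = x \<and> y' < y) \<longrightarrow> s y' < s (a + b + 1 - x')) \<and>
     (\<forall>k\<le>b. s k \<le> s0 k) \<and> (\<forall>k. b < k \<and> k \<le> a + b + 1 \<longrightarrow> s0 k \<le> s k) \<and>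
     (banded (a + b + 1) b s0 \<longrightarrow> banded (a + b + 1) b s)"

lemma net_inv_step:
  assumes inv: "net_inv a b s0 x y s" and "x \<le> a" and "y \<le> b"
  defines "u \<equiv> a + b + 1 - x"
  shows "net_inv a b s0 x (y + 1) (s(u := max (s u) (s y), y := min (s u) (s y)))"
proof -
  let ?n = "a + b + 1"
  let ?s = "s(u := max (s u) (s y), y := min (s u) (s y))"
  have u: "b < u" "u \<le> ?n" and "u \<noteq> y"
    using assms by auto
  have bij: "bij_betw s {0..?n} {1..?n + 1}"
    and order: "\<And>x' y'. x' \<le> a \<Longrightarrow> y' \<le> b \<Longrightarrow> x' < x \<or> x' = x \<and> y' < y \<Longrightarrow> s y' < s (?n - x')"
    and below: "\<And>k. k \<le> b \<Longrightarrow> s k \<le> s0 k" and above: "\<And>k. b < k \<Longrightarrow> k \<le> ?n \<Longrightarrow> s0 k \<le> s k"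
    and band: "banded ?n b s0 \<Longrightarrow> banded ?n b s"
    using inv unfolding net_inv_def by auto
  have inj: "inj_on s {0..?n}" and range: "\<And>k. k \<le> ?n \<Longrightarrow> s k \<in> {1..?n + 1}"
    using bij unfolding bij_betw_def by auto
  \<comment> \<open>A comparator either does nothing or composes with a transposition, so the labels
    stay a bijection.\<close>
  have "?s = (if s y \<le> s u then s else s \<circ> transpose u y)"
    using \<open>u \<noteq> y\<close> by (auto simp: transpose_def fun_eq_iff min_def max_def)
  moreover have "bij_betw (s \<circ> transpose u y) {0..?n} {1..?n + 1}"
    using u \<open>y \<le> b\<close> by (intro bij_betw_trans[OF _ bij] permutes_imp_bij permutes_swap_id) auto
  ultimately have "bij_betw ?s {0..?n} {1..?n + 1}"
    using bij by simp
  moreover have "?s y' < ?s (?n - x')"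
    if "x' \<le> a" "y' \<le> b" "x' < x \<or> x' = x \<and> y' < y + 1" for x' y'
  proof (cases "x' = x \<and> y' = y")
    case True
    have "s u \<noteq> s y"
      using inj_onD[OF inj, of u y] u \<open>u \<noteq> y\<close> \<open>y \<le> b\<close> by auto
    then show ?thesis
      using True \<open>u \<noteq> y\<close> by (auto simp: u_def)
  next
    case False
    then have "s y' < s (?n - x')"
      using order that by auto
    moreover have "?s y' \<le> s y'" and "s (?n - x') \<le> ?s (?n - x')"
      using that u \<open>y \<le> b\<close> by auto
    ultimately show ?thesis by simp
  qed
  moreover have "?s k \<le> s0 k" if "k \<le> b" for k
    using below[OF that] that u by (auto simp: min_def)
  moreover have "s0 k \<le> ?s k" if "b < k" "k \<le> ?n" for k
    using above[OF that] that u \<open>y \<le> b\<close> by auto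
  moreover have "banded ?n b ?s" if "banded ?n b s0"
  proof -
    have s: "banded ?n b s"
      using band that .
    \<comment> \<open>The row value exceeds \<open>y\<close> distinct positive labels, and the column value is exceeded by
      \<open>x\<close> distinct labels, so exchanging the two respects the band.\<close>
    have "s ` {..<y} \<subseteq> {1..<s u}"
      using order[of x] \<open>x \<le> a\<close> \<open>y \<le> b\<close> range u_def by (fastforce simp: less_imp_le)
    then have "card (s ` {..<y}) \<le> s u - 1"
      using card_mono[of "{1..<s u}"] by fastforce
    moreover have "inj_on s {..<y}"
      using inj by (rule inj_on_subset) (use \<open>y \<le> b\<close> in auto)
    moreover have "1 \<le> s u"
      using range u by auto
    ultimately have lower: "y + 1 \<le> s u"
      by (auto simp: card_image)
    have "s ` {u<..?n} \<subseteq> {s y<..?n + 1}"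
    proof
      fix z assume "z \<in> s ` {u<..?n}"
      then obtain k where k: "u < k" "k \<le> ?n" "z = s k" by auto
      then have "s y < s (?n - (?n - k))"
        using \<open>x \<le> a\<close> \<open>y \<le> b\<close> unfolding u_def by (intro order) auto
      then show "z \<in> {s y<..?n + 1}"
        using k range[of k] by auto
    qed
    then have "card (s ` {u<..?n}) \<le> ?n + 1 - s y"
      using card_mono[of "{s y<..?n + 1}"] by fastforce
    moreover have "inj_on s {u<..?n}"
      using inj by (rule inj_on_subset) auto
    moreover have "s y \<le> ?n + 1"
      using range[of y] \<open>y \<le> b\<close> by auto
    ultimately have upper: "s y \<le> u + 1"
      using u by (auto simp: card_image)
    show ?thesis
      using s lower upper u \<open>y \<le> b\<close> \<open>u \<noteq> y\<close> unfolding banded_def by auto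
  qed
  ultimately show ?thesis
    unfolding net_inv_def by (simp add: add.assoc)
qed

text \<open>Only row \<open>x\<close> and column \<open>y\<close> meet at \<open>y - x\<close>:
  columns \<open>k < y\<close> and later rows lie to the left, columns \<open>k > y\<close> and
  finished rows to the right.\<close>

lemma wire_pos_step:
  assumes "x \<le> a" and "y \<le> b"
  defines "u \<equiv> a + b + 1 - x"
  shows "wire_pos a b x (y + 1) =
      (wire_pos a b x y)(u := int y - int x + 1, y := int y - int x - 1)" (is ?step)
    and "{w \<in> {0..a + b + 1}. wire_pos a b x y w = int y - int x} = {u, y}" (is ?eq)
proof -
  show ?step
    using assms(1,2) unfolding u_def by (auto simp: wire_pos_def fun_eq_iff)
  show ?eq
    using assms(1,2) unfolding u_def by (auto simp: wire_pos_def split: if_splits)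
qed

section \<open>Running the network row by row\<close>

lemma wire_pos_next_row: "wire_pos a b (Suc x) 0 k = wire_pos a b x (Suc b) k"
  by (auto simp: wire_pos_def)

lemma net_inv_next_row: "net_inv a b s0 x (Suc b) s \<Longrightarrow> net_inv a b s0 (Suc x) 0 s"
  unfolding net_inv_def by (fastforce simp: less_Suc_eq)

lemma topple_network:
  fixes a b n :: nat and s0 :: "nat \<Rightarrow> nat"
  assumes bij: "bij_betw s0 {0..a + b + 1} {1..a + b + 2}"
    and pos: "{- int a..int b} \<subseteq> positions n"
  defines "C \<equiv> \<lambda>x y. place {0..a + b + 1} (wire_pos a b x y)"
  shows "\<exists>s. (topple n)\<^sup>*\<^sup>* (C 0 0 s0) (C (a + 1) 0 s) \<and> net_inv a b s0 (a + 1) 0 s"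
proof -
  have row: "\<exists>s'. (topple n)\<^sup>*\<^sup>* (C x 0 s) (C x y s') \<and> net_inv a b s0 x y s'"
    if "x \<le> a" "net_inv a b s0 x 0 s" "y \<le> b + 1" for x y s
    using that(3)
  proof (induction y)
    case 0
    then show ?case using that by blast
  next
    case (Suc y)
    then obtain s' where s': "(topple n)\<^sup>*\<^sup>* (C x 0 s) (C x y s')" "net_inv a b s0 x y s'"
      by auto
    define u where "u = a + b + 1 - x"
    let ?s = "s'(u := max (s' u) (s' y), y := min (s' u) (s' y))"
    have inj: "inj_on s' {0..a + b + 1}"
      using s'(2) unfolding net_inv_def bij_betw_def by blast
    have "s' u = s' y \<longleftrightarrow> u = y"
      by (intro inj_on_eq_iff[OF inj]) (use Suc.prems \<open>x \<le> a\<close> in \<open>auto simp: u_def\<close>)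
    then have "s' u \<noteq> s' y"
      using Suc.prems \<open>x \<le> a\<close> unfolding u_def by auto
    moreover have "int y - int x \<in> positions n"
      using pos Suc.prems \<open>x \<le> a\<close> by auto
    ultimately have "topple n (C x y s') (C x (y + 1) ?s)"
      unfolding C_def using wire_pos_step[of x a y b] place_topple Suc.prems \<open>x \<le> a\<close>
      by (simp add: u_def)
    moreover have "net_inv a b s0 x (y + 1) ?s"
      using net_inv_step[OF s'(2)] Suc.prems \<open>x \<le> a\<close> by (simp add: u_def)
    ultimately show ?case
      using s'(1) by (metis Suc_eq_plus1 rtranclp.rtrancl_into_rtrancl)
  qed
  have "\<exists>s. (topple n)\<^sup>*\<^sup>* (C 0 0 s0) (C x 0 s) \<and> net_inv a b s0 x 0 s" if "x \<le> a + 1" for x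
    using that
  proof (induction x)
    case 0
    have "net_inv a b s0 0 0 s0"
      using bij by (simp add: net_inv_def)
    then show ?case by blast
  next
    case (Suc x)
    then obtain s where s: "(topple n)\<^sup>*\<^sup>* (C 0 0 s0) (C x 0 s)" "net_inv a b s0 x 0 s"
      by auto
    then obtain s' where s': "(topple n)\<^sup>*\<^sup>* (C x 0 s) (C x (Suc b) s')" "net_inv a b s0 x (Suc b) s'"
      using row[of x s "Suc b"] Suc.prems by auto
    have "C (Suc x) 0 = C x (Suc b)"
      unfolding C_def place_def by (simp add: wire_pos_next_row)
    then show ?case
      using s s' net_inv_next_row by (metis rtranclp_trans)
  qed
  then show ?thesis by blast
qed

text \<open>A sorted output bounds the input by monotonicity. Conversely, every column ends below
  every row, so the columns hold \<open>{1..b + 1}\<close> and the rows the rest; the band bounds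
  each value on one side by its target, and equal sums leave no slack.\<close>

lemma net_inv_final:
  assumes "net_inv a b s0 (a + 1) 0 s"
  shows "(\<forall>k\<le>a + b + 1. s k = k + 1) \<longleftrightarrow> banded (a + b + 1) b s0"
proof
  let ?n = "a + b + 1"
  have bij: "bij_betw s {0..?n} {1..?n + 1}"
    and order: "\<And>x' y'. x' \<le> a \<Longrightarrow> y' \<le> b \<Longrightarrow> s y' < s (?n - x')"
    and below: "\<And>k. k \<le> b \<Longrightarrow> s k \<le> s0 k" and above: "\<And>k. b < k \<Longrightarrow> k \<le> ?n \<Longrightarrow> s0 k \<le> s k"
    and band: "banded ?n b s0 \<Longrightarrow> banded ?n b s"
    using assms unfolding net_inv_def by auto
  show "banded ?n b s0" if "\<forall>k\<le>?n. s k = k + 1"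
    unfolding banded_def using below above that by fastforce
  assume "banded ?n b s0"
  with band have "banded ?n b s" .
  then have lower: "\<And>k. k \<le> b \<Longrightarrow> k + 1 \<le> s k" and upper: "\<And>k. b < k \<Longrightarrow> k \<le> ?n \<Longrightarrow> s k \<le> k + 1"
    by (auto simp: banded_def)
  have inj: "inj_on s {0..?n}" and range: "\<And>k. k \<le> ?n \<Longrightarrow> s k \<in> {1..?n + 1}"
    using bij unfolding bij_betw_def by auto
  have col_lt_row: "s k < s l" if "k \<le> b" "b < l" "l \<le> ?n" for k l
    using order[of "?n - l" k] that by simp
  have cols: "s ` {0..b} = {1..b + 1}"
  proof (rule card_subset_eq)
    show "s ` {0..b} \<subseteq> {1..b + 1}"
    proof
      fix z assume "z \<in> s ` {0..b}"
      then obtain k where k: "k \<le> b" "z = s k" by auto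
      \<comment> \<open>All \<open>a + 1\<close> row values exceed \<open>z\<close> and are at most
        \<open>a + b + 2\<close>, hence \<open>z <= b + 1\<close>.\<close>
      have "s ` {b<..?n} \<subseteq> {z<..?n + 1}"
        using k col_lt_row[of k] range by fastforce
      then have "card (s ` {b<..?n}) \<le> card {z<..?n + 1}"
        by (rule card_mono[rotated]) simp
      moreover have "inj_on s {b<..?n}"
        using inj by (rule inj_on_subset) auto
      ultimately show "z \<in> {1..b + 1}"
        using k range[of k] by (auto simp: card_image)
    qed
    have "inj_on s {0..b}"
      using inj by (rule inj_on_subset) auto
    then show "card (s ` {0..b}) = card {1..b + 1}"
      by (simp add: card_image)
  qed simp
  have bij_cols: "bij_betw s {0..b} {1..b + 1}"
    unfolding bij_betw_def using cols inj by (auto intro: inj_on_subset)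
  have "bij_betw s ({0..?n} - {0..b}) ({1..?n + 1} - {1..b + 1})"
    using bij cols by (intro bij_betw_DiffI bij_cols) auto
  moreover have "{0..?n} - {0..b} = {b + 1..?n}" "{1..?n + 1} - {1..b + 1} = {b + 2..?n + 1}"
    by auto
  ultimately have bij_rows: "bij_betw s {b + 1..?n} {b + 2..?n + 1}"
    by simp
  have bij_Suc: "bij_betw Suc {i..j} {i + 1..j + 1}" for i j
    by (simp add: bij_betw_def)
  have "sum Suc {0..b} = sum s {0..b}"
    using sum.reindex_bij_betw[OF bij_cols, of "\<lambda>x. x"]
      sum.reindex_bij_betw[OF bij_Suc[of 0 b], of "\<lambda>x. x"] by simp
  then have eq_cols: "Suc k = s k" if "k \<le> b" for k
    by (rule sum_mono_inv[where I = "{0..b}"]) (use lower that in auto)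
  have "sum s {b + 1..?n} = sum Suc {b + 1..?n}"
    using sum.reindex_bij_betw[OF bij_rows, of "\<lambda>x. x"]
      sum.reindex_bij_betw[OF bij_Suc[of "b + 1" ?n], of "\<lambda>x. x"] by simp
  then have eq_rows: "s k = Suc k" if "b < k" "k \<le> ?n" for k
    by (rule sum_mono_inv[where I = "{b + 1..?n}"]) (use upper that in auto)
  show "\<forall>k\<le>?n. s k = k + 1"
    using eq_cols eq_rows by (metis Suc_eq_plus1 not_le)
qed

section \<open>Initial and final configurations\<close>

lemma wire_pos_initial:
  "k \<le> a + b + 1 \<Longrightarrow> wire_pos a b 0 0 k = (if k \<le> b then int k else int k - int (a + b + 1))"
  by (auto simp: wire_pos_def)

lemma wire_pos_final:
  "k \<le> a + b + 1 \<Longrightarrow>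
    wire_pos a b (a + 1) 0 k = (if k \<le> b then int k - int a - 1 else int k - int a)"
  by (auto simp: wire_pos_def)

text \<open>After all comparators the columns have moved left by \<open>a + 1\<close> and the rows
  right by \<open>b + 1\<close>, leaving a single hole at \<open>b - a\<close>.\<close>

lemma place_final:
  "place {0..a + b + 1} (wire_pos a b (a + 1) 0) s i =
    (if - int a - 1 \<le> i \<and> i < int b - int a then {s (nat (i + int a + 1))}
     else if int b - int a < i \<and> i \<le> int b + 1 then {s (nat (i + int a))}
     else {})"
proof -
  have "{k \<in> {0..a + b + 1}. wire_pos a b (a + 1) 0 k = i} =
    (if - int a - 1 \<le> i \<and> i < int b - int a then {nat (i + int a + 1)}
     else if int b - int a < i \<and> i \<le> int b + 1 then {nat (i + int a)}
     else {})" (is "?A = ?B")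
  proof -
    have "?A = {k \<in> {0..a + b + 1}. (if k \<le> b then int k - int a - 1 else int k - int a) = i}"
      using wire_pos_final by auto
    also have "\<dots> = ?B"
      by (auto split: if_splits)
    finally show ?thesis .
  qed
  then show ?thesis
    unfolding place_def by simp
qed

lemma word_final:
  "concat (map (\<lambda>i. sorted_list_of_set (place {0..a + b + 1} (wire_pos a b (a + 1) 0) s i))
      [- int a - 1..int b + 1]) = map s [0..<a + b + 2]" (is "concat (map ?f _) = _")
proof -
  \<comment> \<open>The reading range splits at the hole into the column block and the row block,
    each in wire order.\<close>
  have "[- int a - 1..int b + 1] =
      [- int a - 1..int b - int a - 1] @ [int b - int a..int b + 1]"
    using upto_split1[of "- int a - 1" "int b - int a" "int b + 1"] by simp
  also have "\<dots> = [- int a - 1..int b - int a - 1] @ (int b - int a) # [int b - int a + 1..int b + 1]"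
    by (simp add: upto_rec1)
  finally have split: "[- int a - 1..int b + 1] = \<dots>" .
  have concat_single: "concat (map (\<lambda>i. [g i]) xs) = map g xs" for g :: "int \<Rightarrow> nat" and xs
    by (induction xs) auto
  have "concat (map ?f [- int a - 1..int b - int a - 1]) =
      concat (map (\<lambda>i. [s (nat (i + int a + 1))]) [- int a - 1..int b - int a - 1])"
    by (intro arg_cong[where f = concat] map_cong) (auto simp: place_final[simplified])
  also have "\<dots> = map s [0..<b + 1]"
    unfolding concat_single by (rule nth_equalityI) (auto simp: nth_upto simp del: upt_Suc)
  finally have left: "concat (map ?f [- int a - 1..int b - int a - 1]) = map s [0..<b + 1]" .
  have "concat (map ?f [int b - int a + 1..int b + 1]) =
      concat (map (\<lambda>i. [s (nat (i + int a))]) [int b - int a + 1..int b + 1])"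
    by (intro arg_cong[where f = concat] map_cong) (auto simp: place_final[simplified])
  also have "\<dots> = map s [b + 1..<a + b + 2]"
    unfolding concat_single
    by (rule nth_equalityI) (auto simp: nth_upto simp del: upt_Suc intro!: arg_cong[of _ _ s])
  finally have right: "concat (map ?f [int b - int a + 1..int b + 1]) = map s [b + 1..<a + b + 2]" .
  have mid: "?f (int b - int a) = []"
    by (simp add: place_final[simplified])
  have "map s [0..<b + 1] @ map s [b + 1..<a + b + 2] = map s [0..<a + b + 2]"
    using upt_add_eq_append[of 0 "b + 1" "a + 1"] by (simp del: upt_Suc flip: map_append add: add_ac)
  then show ?thesis
    unfolding split using left right mid by simp
qed

section \<open>Initial labels on the wires\<close>

definition relabel :: "nat \<Rightarrow> nat \<Rightarrow> nat" where
  "relabel r v = (if v < r then v else v + 1)"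

text \<open>
  The two chips at the origin start on column \<open>0\<close> and row \<open>0\<close>; we put \<open>r\<close> on the column.
\<close>

definition init_wires :: "nat \<Rightarrow> nat \<Rightarrow> (nat \<Rightarrow> nat) \<Rightarrow> nat \<Rightarrow> nat \<Rightarrow> nat" where
  "init_wires a b \<pi> r k =
     (if k = 0 then r else relabel r (\<pi> (if k \<le> b then a + 1 + k else k - b)))"

lemma bij_init_wires:
  assumes "\<pi> permutes {1..a + b + 1}" and "r \<in> {1..a + b + 2}"
  shows "bij_betw (init_wires a b \<pi> r) {0..a + b + 1} {1..a + b + 2}"
proof -
  let ?s = "init_wires a b \<pi> r" and ?h = "\<lambda>k. if k \<le> b then a + 1 + k else k - b"
  have inj_relabel: "inj (relabel r)" and relabel_ne: "\<And>v. relabel r v \<noteq> r"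
    by (auto simp: relabel_def inj_def split: if_splits)
  have inj_h: "inj_on ?h {1..a + b + 1}"
    by (auto simp: inj_on_def)
  have "inj_on ?s {0..a + b + 1}"
  proof (rule inj_onI)
    fix k l assume kl: "k \<in> {0..a + b + 1}" "l \<in> {0..a + b + 1}" "?s k = ?s l"
    show "k = l"
    proof (cases "k = 0 \<or> l = 0")
      case True
      then show ?thesis
        using kl(3) relabel_ne by (metis init_wires_def)
    next
      case False
      then have "?h k = ?h l"
        using kl(3) inj_relabel permutes_inj[OF assms(1)]
        unfolding init_wires_def by (simp only: if_False inj_eq de_Morgan_disj)
      then show ?thesis
        using inj_h False kl by (auto dest!: inj_onD simp: Suc_le_eq)
    qed
  qed
  moreover have "?s ` {0..a + b + 1} = {1..a + b + 2}"
  proof (rule card_subset_eq)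
    have "\<pi> (?h k) \<in> {1..a + b + 1}" if "0 < k" "k \<le> a + b + 1" for k
      using that permutes_in_image[OF assms(1), of "?h k"] by auto
    then show "?s ` {0..a + b + 1} \<subseteq> {1..a + b + 2}"
      using assms(2) by (fastforce simp: init_wires_def relabel_def)
    show "card (?s ` {0..a + b + 1}) = card {1..a + b + 2}"
      using calculation by (simp add: card_image)
  qed simp
  ultimately show ?thesis
    unfolding bij_betw_def ..
qed

lemma init_config_place:
  assumes "(n - 1) div 2 = a" and "n = a + b + 1"
  shows "init_config n \<pi> r = place {0..a + b + 1} (wire_pos a b 0 0) (init_wires a b \<pi> r)"
proof
  fix i
  let ?R = "place {0..a + b + 1} (wire_pos a b 0 0) (init_wires a b \<pi> r) i"
  have R: "?R = init_wires a b \<pi> r ` {k. k \<le> a + b + 1 \<and>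
      (if k \<le> b then int k else int k - int (a + b + 1)) = i}"
    unfolding place_def by (intro arg_cong[where f = "image _"]) (auto simp: wire_pos_initial)
  have L: "init_config n \<pi> r i =
      {relabel r (\<pi> j) | j. j \<in> {1..n} \<and> i = int j - int a - 1} \<union> (if i = 0 then {r} else {})"
    unfolding init_config_def relabel_def assms(1) by auto
  show "init_config n \<pi> r i = ?R"
  proof (intro equalityI subsetI)
    fix v assume "v \<in> init_config n \<pi> r i"
    then consider j where "v = relabel r (\<pi> j)" "j \<in> {1..n}" "i = int j - int a - 1"
      | "i = 0" "v = r"
      unfolding L by (auto split: if_splits)
    then show "v \<in> ?R"
    proof cases
      case 1
      \<comment> \<open>Entry \<open>j\<close> starts at \<open>j - a - 1\<close>. The entry at the
        origin, \<open>j = a + 1\<close>, must go to row \<open>0\<close>, that is wire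
        \<open>a + b + 1\<close>, since \<open>r\<close> occupies column \<open>0\<close>.\<close>
      show ?thesis
        unfolding R
        by (rule image_eqI[of _ _ "if j \<le> a + 1 then j + b else j - a - 1"])
          (use 1 assms(2) in \<open>auto simp: init_wires_def\<close>)
    next
      case 2
      show ?thesis
        unfolding R by (rule image_eqI[of _ _ 0]) (use 2 in \<open>auto simp: init_wires_def\<close>)
    qed
  next
    fix v assume "v \<in> ?R"
    then obtain k where k: "v = init_wires a b \<pi> r k" "k \<le> a + b + 1"
      "(if k \<le> b then int k else int k - int (a + b + 1)) = i"
      unfolding R by auto
    show "v \<in> init_config n \<pi> r i"
    proof (cases "k = 0")
      case True
      then show ?thesis
        using k unfolding L by (auto simp: init_wires_def)
    next
      case False
      then show ?thesis
        using k assms(2) unfolding L init_wires_def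
        by (intro UnI1 CollectI exI[of _ "if k \<le> b then a + 1 + k else k - b"])
          (auto split: if_splits)
    qed
  qed
qed

text \<open>Only the origin can hold two chips, so the separation condition is vacuous.\<close>

lemma sparse_init_config: "sparse (init_config n \<pi> r)"
proof -
  let ?c = "init_config n \<pi> r"
  \<comment> \<open>\<open>nat\<close> recovers the only possible index \<open>j\<close> at position
    \<open>i\<close>; where no entry starts, the singleton is merely an upper bound.\<close>
  let ?S = "\<lambda>i. {relabel r (\<pi> (nat (i + int ((n - 1) div 2) + 1)))}"
  have sub: "?c i \<subseteq> ?S i \<union> (if i = 0 then {r} else {})" for i
  proof
    fix v assume "v \<in> ?c i"
    moreover have "v \<in> (if i = 0 then {r} else {}) \<Longrightarrow> i = 0 \<and> v = r"
      by (simp split: if_splits)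
    ultimately consider j where "v = relabel r (\<pi> j)" "i = - int ((n - 1) div 2) + int j - 1"
      | "i = 0" "v = r"
      unfolding init_config_def relabel_def by blast
    then show "v \<in> ?S i \<union> (if i = 0 then {r} else {})"
    proof cases
      case 1
      then have "j = nat (i + int ((n - 1) div 2) + 1)"
        by linarith
      then show ?thesis
        using 1(1) by blast
    qed simp
  qed
  have fin: "finite (?c i)" for i
    by (rule finite_subset[OF sub]) auto
  have "card (?c i) \<le> card (?S i \<union> (if i = 0 then {r} else {}))" for i
    by (rule card_mono[OF _ sub]) auto
  also have "\<dots> i \<le> (if i = 0 then 2 else 1)" for i
    by (auto simp: card_insert_if)
  finally have "card (?c i) \<le> (if i = 0 then 2 else 1)" for i .
  then show ?thesis
    unfolding sparse_def using fin by (metis (full_types) less_irrefl one_le_numeral order_trans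
        Suc_1 not_less_eq_eq One_nat_def order_refl)
qed

text \<open>The explicit network run ends in a stable configuration, so uniqueness identifies it
  with the final one, and its reading word lists the labels in wire order.\<close>

lemma r_toppleable_iff_banded:
  assumes "n \<ge> 1" and "\<pi> permutes {1..n}" and "r \<in> {1..n + 1}"
  shows "r_toppleable n r \<pi> \<longleftrightarrow> banded n (n div 2) (init_wires ((n - 1) div 2) (n div 2) \<pi> r)"
proof -
  define a where "a = (n - 1) div 2"
  define b where "b = n div 2"
  have n: "n = a + b + 1" and half: "(n + 1) div 2 = a + 1"
    using assms(1) unfolding a_def b_def by presburger+
  let ?s0 = "init_wires a b \<pi> r"
  have pos: "positions n = {- int a - 1..int b + 1}"
    unfolding positions_def half b_def[symmetric] by simp
  have "bij_betw ?s0 {0..a + b + 1} {1..a + b + 2}"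
    using assms bij_init_wires n by simp
  moreover have "{- int a..int b} \<subseteq> positions n"
    unfolding pos by auto
  ultimately obtain s where s: "(topple n)\<^sup>*\<^sup>* (place {0..a + b + 1} (wire_pos a b 0 0) ?s0)
        (place {0..a + b + 1} (wire_pos a b (a + 1) 0) s)"
      "net_inv a b ?s0 (a + 1) 0 s"
    using topple_network by blast
  let ?c = "place {0..a + b + 1} (wire_pos a b (a + 1) 0) s"
  have "stable n ?c"
    unfolding stable_def by (simp add: place_final[simplified])
  then have "final_config n \<pi> r = ?c"
    using s(1) unfolding init_config_place[OF a_def[symmetric] n, of \<pi> r, symmetric]
    by (intro final_config_eq sparse_init_config)
  moreover have ends: "- int (a + 1) = - int a - 1"
    by simp
  ultimately have "chip_word n (final_config n \<pi> r) = map s [0..<a + b + 2]"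
    using word_final[of a b s] unfolding chip_word_def half b_def[symmetric] ends by (simp only:)
  then have "T n \<pi> r k = (if k \<in> {1..n + 1} then s (k - 1) else k)" for k
    unfolding T_def n by (auto simp del: upt_Suc)
  then have "r_toppleable n r \<pi> \<longleftrightarrow> (\<forall>k\<in>{1..n + 1}. s (k - 1) = k)"
    unfolding r_toppleable_def fun_eq_iff by auto
  also have "\<dots> \<longleftrightarrow> (\<forall>k\<le>n. s k = k + 1)"
  proof
    assume *: "\<forall>k\<in>{1..n + 1}. s (k - 1) = k"
    show "\<forall>k\<le>n. s k = k + 1"
      using *[rule_format, of "Suc _"] by auto
  qed auto
  also have "\<dots> \<longleftrightarrow> banded n b ?s0"
    using net_inv_final[OF s(2)] n by simp
  finally show ?thesis
    unfolding a_def b_def .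
qed

section \<open>Band permutations and excedances\<close>

text \<open>The band \<open>i - a <= \<pi> i <= i + b\<close>, written with \<open>+ a\<close> to
  avoid truncated subtraction.\<close>

definition in_band :: "nat \<Rightarrow> nat \<Rightarrow> nat \<Rightarrow> (nat \<Rightarrow> nat) \<Rightarrow> bool" where
  "in_band n a b \<pi> \<longleftrightarrow> (\<forall>i\<in>{1..n}. i \<le> \<pi> i + a \<and> \<pi> i \<le> i + b)"

text \<open>\<open>relabel\<close> adds 0 or 1: this helps the columns, and on row wire
  \<open>k\<close> the band gives \<open>\<pi> (k - b) <= k\<close>, leaving exactly 1 to spare.
  Column \<open>0\<close> carries \<open>r >= 1\<close>.\<close>

lemma in_band_imp_banded:
  assumes "in_band (a + b + 1) a b \<pi>" and "1 \<le> r"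
  shows "banded (a + b + 1) b (init_wires a b \<pi> r)"
  unfolding banded_def
proof (intro conjI allI impI)
  fix k
  show "k + 1 \<le> init_wires a b \<pi> r k" if "k \<le> b"
    using assms(1)[unfolded in_band_def, rule_format, of "a + 1 + k"] that assms(2)
    by (auto simp: init_wires_def relabel_def)
  show "init_wires a b \<pi> r k \<le> k + 1" if "b < k \<and> k \<le> a + b + 1"
  proof -
    have "k - b \<in> {1..a + b + 1}"
      using that by auto
    then have "\<pi> (k - b) \<le> k - b + b"
      using assms(1) unfolding in_band_def by blast
    then show ?thesis
      using that by (auto simp: init_wires_def relabel_def)
  qed
qed

text \<open>The two middle labels matter when \<open>relabel\<close> could hide a violation. On
  rows, an unshifted value is below \<open>r <= b + 2\<close>, hence at most \<open>i + b\<close>;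
  on columns, a value that gets shifted is at least \<open>r >= b + 1 >= i - a\<close>. The opposite
  bounds follow from the range of \<open>\<pi>\<close>.\<close>

lemma banded_imp_in_band:
  assumes "\<pi> permutes {1..a + b + 1}" and "r = b + 1 \<or> r = b + 2"
    and "banded (a + b + 1) b (init_wires a b \<pi> r)"
  shows "in_band (a + b + 1) a b \<pi>"
  unfolding in_band_def
proof
  fix i assume i: "i \<in> {1..a + b + 1}"
  then have range: "1 \<le> \<pi> i" "\<pi> i \<le> a + b + 1"
    using permutes_in_image[OF assms(1)] by auto
  show "i \<le> \<pi> i + a \<and> \<pi> i \<le> i + b"
  proof (cases "i \<le> a + 1")
    case True
    then have "init_wires a b \<pi> r (i + b) \<le> i + b + 1"
      using assms(3) i unfolding banded_def by simp
    then have "relabel r (\<pi> i) \<le> i + b + 1"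
      using i by (auto simp: init_wires_def)
    then show ?thesis
      using True range i assms(2) by (auto simp: relabel_def split: if_splits)
  next
    case False
    then have "i - a - 1 + 1 \<le> init_wires a b \<pi> r (i - a - 1)"
      using assms(3) i unfolding banded_def by simp
    then have "i - a \<le> relabel r (\<pi> i)"
      using i False by (simp add: init_wires_def split: if_splits)
    then show ?thesis
      using False range i assms(2) by (auto simp: relabel_def split: if_splits)
  qed
qed

lemma card_in_band_eq_num_excedance:
  "card {\<pi>. \<pi> permutes {1..a + b + 1} \<and> in_band (a + b + 1) a b \<pi>} = num_excedance (a + b + 1) a"
proof -
  define n where "n = a + b + 1"
  \<comment> \<open>\<open>w\<close> reverses \<open>{1..n}\<close>, while \<open>\<rho>\<close>
    reverses \<open>{1..a}\<close> and \<open>{a + 1..n}\<close> separately and so preserves the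
    condition \<open>i <= a\<close>.\<close>
  define w where "w i = (if i \<in> {1..n} then n + 1 - i else i)" for i
  define \<rho> where "\<rho> i = (if i \<in> {1..a} then a + 1 - i
      else if i \<in> {a + 1..n} then n + 1 + a - i else i)" for i
  have involutions: "w \<circ> w = id" "\<rho> \<circ> \<rho> = id"
    by (auto simp: w_def \<rho>_def n_def fun_eq_iff)
  have inv_perm: "f permutes S" if "f \<circ> f = id" "\<And>i. i \<notin> S \<Longrightarrow> f i = i" for f :: "nat \<Rightarrow> nat" and S
    unfolding permutes_def using that by (metis comp_apply id_apply)
  have perms: "w permutes {1..n}" "\<rho> permutes {1..n}"
    by (auto intro!: inv_perm involutions simp: w_def \<rho>_def n_def)
  have inv_phi: "w \<circ> (w \<circ> \<pi> \<circ> \<rho>) \<circ> \<rho> = \<pi>" for \<pi>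
    using involutions by (metis comp_assoc comp_id id_comp)
  have perm_phi: "w \<circ> \<pi> \<circ> \<rho> permutes {1..n}" if "\<pi> permutes {1..n}" for \<pi>
    using that perms by (intro permutes_compose)
  have key: "excedance_set n (w \<circ> \<pi> \<circ> \<rho>) = {1..a} \<longleftrightarrow> in_band n a b \<pi>"
    if \<pi>: "\<pi> permutes {1..n}" for \<pi>
  proof -
    have range: "1 \<le> \<pi> i \<and> \<pi> i \<le> n" if "i \<in> {1..n}" for i
      using permutes_in_image[OF \<pi>, of i] that by auto
    have "{1..a} = {i \<in> {1..n}. i \<le> a}"
      unfolding n_def by auto
    then have "excedance_set n (w \<circ> \<pi> \<circ> \<rho>) = {1..a} \<longleftrightarrow>
        (\<forall>i\<in>{1..n}. i < w (\<pi> (\<rho> i)) \<longleftrightarrow> i \<le> a)"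
      unfolding excedance_set_def comp_apply by blast
    \<comment> \<open>Reindexing by the involution \<open>\<rho>\<close> frees the argument of
      \<open>\<pi>\<close>.\<close>
    also have "\<dots> \<longleftrightarrow> (\<forall>i\<in>{1..n}. \<rho> i < w (\<pi> i) \<longleftrightarrow> \<rho> i \<le> a)"
      using permutes_in_image[OF perms(2)] involutions(2)
      by (metis comp_apply id_apply)
    also have "\<dots> \<longleftrightarrow> (\<forall>i\<in>{1..n}. i \<le> \<pi> i + a \<and> \<pi> i \<le> i + b)"
    proof (intro ball_cong refl)
      fix i assume i: "i \<in> {1..n}"
      \<comment> \<open>For \<open>i <= a\<close>, an excedance at \<open>\<rho> i\<close> means
        \<open>\<pi> i <= i + b\<close>; for \<open>i > a\<close>, a non-excedance there means
        \<open>i <= \<pi> i + a\<close>. The other half of the band is automatic from the range in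
        each case.\<close>
      show "(\<rho> i < w (\<pi> i) \<longleftrightarrow> \<rho> i \<le> a) \<longleftrightarrow> i \<le> \<pi> i + a \<and> \<pi> i \<le> i + b"
        using i range[OF i] by (auto simp: w_def \<rho>_def n_def)
    qed
    finally show ?thesis
      unfolding in_band_def .
  qed
  have "bij_betw (\<lambda>\<pi>. w \<circ> \<pi> \<circ> \<rho>) {\<pi>. \<pi> permutes {1..n} \<and> in_band n a b \<pi>}
      {\<sigma>. \<sigma> permutes {1..n} \<and> excedance_set n \<sigma> = {1..a}}"
  \<comment> \<open>The map is its own inverse because \<open>w\<close> and \<open>\<rho>\<close>
    are involutions.\<close>
  proof (rule bij_betw_byWitness[where f' = "\<lambda>\<pi>. w \<circ> \<pi> \<circ> \<rho>"])
    show "(\<lambda>\<pi>. w \<circ> \<pi> \<circ> \<rho>) ` {\<sigma>. \<sigma> permutes {1..n} \<and> excedance_set n \<sigma> = {1..a}}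
        \<subseteq> {\<pi>. \<pi> permutes {1..n} \<and> in_band n a b \<pi>}"
      using key perm_phi inv_phi by (smt (verit) image_subsetI mem_Collect_eq)
  qed (use inv_phi key perm_phi in auto)
  then show ?thesis
    unfolding num_excedance_def n_def[symmetric] by (rule bij_betw_same_card)
qed

theorem theorem2p4:
  fixes n :: nat
  assumes "n \<ge> 2"
  shows "num_toppleable n = num_r_toppleable (n div 2 + 1) n
    \<and> num_toppleable n = num_r_toppleable (n div 2 + 2) n
    \<and> num_toppleable n = num_excedance n ((n - 1) div 2)"
proof -
  define a where "a = (n - 1) div 2"
  define b where "b = n div 2"
  have n: "n = a + b + 1"
    using assms unfolding a_def b_def by presburger
  have iff: "r_toppleable n r \<pi> \<longleftrightarrow> banded n b (init_wires a b \<pi> r)"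
    if "\<pi> permutes {1..n}" "r \<in> {1..n + 1}" for r \<pi>
    using r_toppleable_iff_banded[OF _ that] assms unfolding a_def b_def by simp
  have mid: "r_toppleable n r \<pi> \<longleftrightarrow> in_band n a b \<pi>"
    if "\<pi> permutes {1..n}" "r = b + 1 \<or> r = b + 2" for r \<pi>
  proof -
    have "r \<in> {1..n + 1}"
      using that n assms by auto
    then show ?thesis
      using iff that in_band_imp_banded[of a b \<pi> r] banded_imp_in_band[of \<pi> a b r] n by auto
  qed
  \<comment> \<open>The single label \<open>b + 1\<close> already forces the band, and the band in
    turn gives every label.\<close>
  have "toppleable n \<pi> \<longleftrightarrow> in_band n a b \<pi>" if "\<pi> permutes {1..n}" for \<pi>
  proof
    assume "toppleable n \<pi>"
    then have "r_toppleable n (b + 1) \<pi>"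
      unfolding toppleable_def using n by auto
    then show "in_band n a b \<pi>"
      using mid that by blast
  next
    assume "in_band n a b \<pi>"
    then show "toppleable n \<pi>"
      unfolding toppleable_def using iff that in_band_imp_banded n by simp
  qed
  then have "num_toppleable n = card {\<pi>. \<pi> permutes {1..n} \<and> in_band n a b \<pi>}"
    unfolding num_toppleable_def by (intro arg_cong[where f = card]) auto
  moreover have "num_r_toppleable r n = card {\<pi>. \<pi> permutes {1..n} \<and> in_band n a b \<pi>}"
    if "r = b + 1 \<or> r = b + 2" for r
    unfolding num_r_toppleable_def using mid that by (intro arg_cong[where f = card]) auto
  ultimately show ?thesis
    using card_in_band_eq_num_excedance[of a b] n unfolding a_def[symmetric] b_def[symmetric] by simp
qed

end
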